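(* Let $n,m>1$ be coprime integers and let $\xi_m$ be a primitive $m$-th root of unity. For every Dirichlet character $\chi$ modulo $m$ put $$c_\chi(\xi_m)=\sum_{g\in G(m)}\frac{\xi_m^{-1}\xi_m^{g}}{1-\xi_m^{g}}\,\overline{\chi}(g).$$ Then $$f_n(\xi_m)=-\frac{n}{\varphi(m)}\sum_{\chi\in\widehat{G}(m)}c_\chi(\xi_m)\,\chi(n)\prod_{p\mid n}\Bigl(1-\frac{\overline{\chi}(p)}{p}\Bigr),$$ where the product runs over the primes $p$ dividing $n$.
   Context: $\Phi_n(x)=\prod_{1\le j\le n,\ \gcd(j,n)=1}(x-e^{2\pi i j/n})$ is the $n$-th cyclotomic polynomial and $f_n(z)=\Phi_n'(z)/\Phi_n(z)$ is its logarithmic derivative. $\varphi$ is Euler's totient function. $G(m)=(\mathbb Z/m\mathbb Z)^*$ and $\widehat{G}(m)=\mathrm{Hom}((\mathbb Z/m\mathbb Z)^*,\mathbb C^* )$ is the set of Dirichlet characters modulo $m$. *)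

theory Defs
  imports
    Complex_Main
    "HOL-Computational_Algebra.Computational_Algebra"
    "HOL-Number_Theory.Number_Theory"
begin

definition cyclotomic_poly :: "nat \<Rightarrow> complex poly" where
  "cyclotomic_poly n =
     (\<Prod>j\<in>{j\<in>{1..n}. coprime j n}. [:- exp (2 * of_real pi * \<i> * of_nat j / of_nat n), 1:])"

definition cyclotomic_logderiv :: "nat \<Rightarrow> complex \<Rightarrow> complex" where
  "cyclotomic_logderiv n z = poly (pderiv (cyclotomic_poly n)) z / poly (cyclotomic_poly n) z"

definition primitive_root_of_unity :: "nat \<Rightarrow> complex \<Rightarrow> bool" where
  "primitive_root_of_unity m z \<longleftrightarrow> z ^ m = 1 \<and> (\<forall>k. 0 < k \<and> k < m \<longrightarrow> z ^ k \<noteq> 1)"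

definition residue_units :: "nat \<Rightarrow> int monoid" where
  "residue_units m = units_of (residue_ring (int m))"

definition complex_mult_group :: "complex monoid" where
  "complex_mult_group = \<lparr>carrier = UNIV - {0}, monoid.mult = (*), one = 1\<rparr>"

text \<open>Members of \<^const>\<open>hom\<close> are arbitrary off the carrier; extensionality makes each
  homomorphism correspond to exactly one function, so that sums over the dual group are correct.\<close>

definition dual_group :: "nat \<Rightarrow> (int \<Rightarrow> complex) set" where
  "dual_group m = hom (residue_units m) complex_mult_group \<inter> extensional (carrier (residue_units m))"

text \<open>The usual extension of a character to all natural numbers: reduce modulo \<open>m\<close>, and take the
  value 0 at arguments not coprime to \<open>m\<close>.\<close>

definition char_at :: "nat \<Rightarrow> (int \<Rightarrow> complex) \<Rightarrow> nat \<Rightarrow> complex" where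
  "char_at m \<psi> k = (if coprime k m then \<psi> (int k mod int m) else 0)"

text \<open>Elements of \<open>carrier (residue_units m)\<close> are integers in \<open>{0..m - 1}\<close>, so \<open>\<xi> ^ nat g\<close> is
  the power of \<open>\<xi>\<close> by the residue class of \<open>g\<close> whenever \<open>\<xi> ^ m = 1\<close>.\<close>

definition char_coeff :: "nat \<Rightarrow> (int \<Rightarrow> complex) \<Rightarrow> complex \<Rightarrow> complex" where
  "char_coeff m \<psi> \<xi> =
     (\<Sum>g\<in>carrier (residue_units m). inverse \<xi> * \<xi> ^ nat g / (1 - \<xi> ^ nat g) * cnj (\<psi> g))"

end

(*
  Inclusion-exclusion over the sets S of primes dividing n expresses the condition gcd(j, n) = 1, and
  the logarithmic derivative of X^k - 1 is k X^(k-1) / (X^k - 1); hence f_n(z) is the sum over S of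
  (-1)^|S| k z^(k-1) / (z^k - 1), where k = n / (product of S).  On the character side, expanding the
  Euler product over the same sets S and using chi(n) * cnj (chi(d)) = chi(n/d) for d dividing n turns
  each summand into sum_chi c_chi chi(k), which orthogonality evaluates to phi(m) times the summand
  of c_chi at g = k.  Orthogonality requires that the characters of a finite abelian group separate its
  points; this is proved by extending a character from a subgroup one generator at a time.
*)

theory Submission
  imports Defs
begin

section \<open>Characters on subgroups and their extension\<close>

text \<open>A homomorphism to the nonzero complex numbers whose domain is an explicit set
  \<open>H\<close>. This lets the domain grow while a character is being extended; values outside
  \<open>H\<close> are unconstrained.\<close>

definition partial_char :: "('a, 'b) monoid_scheme \<Rightarrow> 'a set \<Rightarrow> ('a \<Rightarrow> complex) \<Rightarrow> bool" where
  "partial_char G H \<chi> \<longleftrightarrow>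
     (\<forall>a\<in>H. \<chi> a \<noteq> 0) \<and> (\<forall>a\<in>H. \<forall>b\<in>H. \<chi> (a \<otimes>\<^bsub>G\<^esub> b) = \<chi> a * \<chi> b)"

text \<open>The general form of \<open>dual_group\<close>. Extensionality gives each homomorphism a
  single representative, so that counting and summing over this set are meaningful.\<close>

definition characters :: "('a, 'b) monoid_scheme \<Rightarrow> ('a \<Rightarrow> complex) set" where
  "characters G = hom G complex_mult_group \<inter> extensional (carrier G)"

lemma characters_iff:
  "\<chi> \<in> characters G \<longleftrightarrow> partial_char G (carrier G) \<chi> \<and> \<chi> \<in> extensional (carrier G)"
  by (auto simp: characters_def hom_def partial_char_def complex_mult_group_def Pi_iff)

context group
begin

lemma partial_char_one:
  assumes "subgroup H G" "partial_char G H \<chi>"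
  shows "\<chi> \<one> = 1"
proof -
  have "\<one> \<in> H" using assms(1) by (rule subgroup.one_closed)
  hence "\<chi> (\<one> \<otimes> \<one>) = \<chi> \<one> * \<chi> \<one>" "\<chi> \<one> \<noteq> 0"
    using assms(2) unfolding partial_char_def by blast+
  thus ?thesis by simp
qed

lemma partial_char_inv:
  assumes "subgroup H G" "partial_char G H \<chi>" "a \<in> H"
  shows "\<chi> (inv a) = inverse (\<chi> a)"
proof -
  have a: "a \<in> carrier G" "inv a \<in> H"
    using assms subgroup.mem_carrier subgroup.m_inv_closed by fast+
  have "\<chi> (a \<otimes> inv a) = \<chi> a * \<chi> (inv a)"
    using assms(2,3) a(2) unfolding partial_char_def by blast
  thus ?thesis
    using a partial_char_one[OF assms(1,2)] by (simp add: inverse_unique)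
qed

lemma partial_char_pow:
  assumes "subgroup H G" "partial_char G H \<chi>" "a \<in> H"
  shows "\<chi> (a [^] (i::nat)) = \<chi> a ^ i"
proof (induction i)
  case 0
  show ?case using partial_char_one[OF assms(1,2)] by simp
next
  case (Suc i)
  have "a [^] i \<in> H"
    using assms(1,3) by (metis subgroup_int_pow_closed int_pow_int)
  hence "\<chi> (a [^] i \<otimes> a) = \<chi> (a [^] i) * \<chi> a"
    using assms(2,3) unfolding partial_char_def by blast
  thus ?case using Suc by simp
qed

lemma partial_char_int_pow:
  assumes "subgroup H G" "partial_char G H \<chi>" "a \<in> H"
  shows "\<chi> (a [^] (i::int)) = \<chi> a powi i"
proof (cases "i \<ge> 0")
  case True
  then obtain k where "i = int k" using nonneg_int_cases by blast
  thus ?thesis using partial_char_pow[OF assms, of k] by (simp add: int_pow_int)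
next
  case False
  then obtain k where k: "i = - int k" by (metis int_cases2 of_nat_0_le_iff)
  have a: "a \<in> carrier G" using assms subgroup.mem_carrier by fast
  have "a [^] k \<in> H"
    using assms(1,3) by (metis subgroup_int_pow_closed int_pow_int)
  hence "\<chi> (inv (a [^] k)) = inverse (\<chi> a ^ k)"
    using partial_char_inv[OF assms(1,2)] partial_char_pow[OF assms] by simp
  thus ?thesis using k a by (simp add: int_pow_neg_int power_int_minus)
qed

lemma finite_pow_eq_one:
  assumes "finite (carrier G)" "x \<in> carrier G"
  shows "\<exists>k>0::nat. x [^] k = \<one>"
  using assms order_gt_0_iff_finite pow_order_eq_1 by blast

end

context comm_group
begin

text \<open>The subgroup generated by \<open>H\<close> and \<open>x\<close> consists of the elements
  \<open>h \<otimes> x [^] i\<close>, and the extension sends such an element to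
  \<open>\<chi> h * w powi i\<close>. This is well defined because \<open>x [^] t\<close> lies in
  \<open>H\<close> only for multiples \<open>t\<close> of \<open>k\<close>, and there the choice
  \<open>w ^ k = \<chi> (x [^] k)\<close> makes both prescriptions agree.\<close>

lemma partial_char_extend_step:
  assumes H: "subgroup H G" and \<chi>: "partial_char G H \<chi>" and x: "x \<in> carrier G"
    and k: "k > 0" "x [^] k \<in> H" and kmin: "\<And>j. 0 < j \<Longrightarrow> j < k \<Longrightarrow> x [^] j \<notin> H"
    and w: "w ^ k = \<chi> (x [^] (k::nat))"
  shows "\<exists>H' \<chi>'. subgroup H' G \<and> H \<subseteq> H' \<and> x \<in> H' \<and> partial_char G H' \<chi>' \<and> \<chi>' x = w \<and>
           (\<forall>h\<in>H. \<chi>' h = \<chi> h)"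
proof -
  have HG: "h \<in> carrier G" if "h \<in> H" for h using H that subgroup.mem_carrier by fast
  have Hm: "a \<otimes> b \<in> H" if "a \<in> H" "b \<in> H" for a b
    using H that subgroup.m_closed by fast
  have Hi: "inv a \<in> H" if "a \<in> H" for a
    using H that subgroup.m_inv_closed by fast
  have H1: "\<one> \<in> H" using H by (rule subgroup.one_closed)
  have \<chi>m: "\<chi> (a \<otimes> b) = \<chi> a * \<chi> b" if "a \<in> H" "b \<in> H" for a b
    using \<chi> that unfolding partial_char_def by blast
  have \<chi>0: "\<chi> a \<noteq> 0" if "a \<in> H" for a
    using \<chi> that unfolding partial_char_def by blast
  have w0: "w \<noteq> 0" using w \<chi>0[OF k(2)] k(1) by (auto simp: zero_power)
  \<comment> \<open>Compatibility on the overlap of \<open>H\<close> with the powers of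
    \<open>x\<close>; well-definedness reduces to this.\<close>
  have powH: "\<chi> (x [^] t) = w powi t" if t: "x [^] t \<in> H" for t :: int
  proof -
    have split: "t = int k * (t div int k) + t mod int k" by simp
    have xk: "(x [^] k) [^] i = x [^] (int k * i)" for i :: int
      using x by (metis int_pow_int int_pow_pow)
    have xkH: "(x [^] k) [^] i \<in> H" for i :: int
      using H k(2) by (rule subgroup_int_pow_closed)
    \<comment> \<open>Removing a power of \<open>x [^] k\<close> from \<open>x [^] t\<close> leaves
      the remainder exponent, still inside \<open>H\<close>. As the remainder is smaller than
      \<open>k\<close>, minimality of \<open>k\<close> forces it to be 0.\<close>
    have "x [^] (t mod int k) = x [^] t \<otimes> inv (x [^] (int k * (t div int k)))"
      using x int_pow_diff[OF x, of t "int k * (t div int k)"]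
      by (simp add: minus_mult_div_eq_mod)
    also have "\<dots> \<in> H" using t xkH xk Hi Hm by metis
    finally have "x [^] (nat (t mod int k)) \<in> H"
      using k(1) by (metis int_pow_int nat_0_le of_nat_0_less_iff pos_mod_sign)
    moreover have "nat (t mod int k) < k"
      using k(1) by (simp add: nat_less_iff)
    ultimately have "nat (t mod int k) = 0" using kmin by blast
    hence "t mod int k = 0" using k(1) by (simp add: nat_eq_iff)
    hence tq: "t = int k * (t div int k)" using split by simp
    have "\<chi> (x [^] t) = \<chi> ((x [^] k) [^] (t div int k))" using tq xk by metis
    also have "\<dots> = (w ^ k) powi (t div int k)"
      using partial_char_int_pow[OF H \<chi> k(2)] w by simp
    also have "\<dots> = w powi t"
      using tq by (metis power_int_mult power_int_of_nat)
    finally show ?thesis .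
  qed
  \<comment> \<open>The graph of the extension, taken as a relation because an element may have many
    representations \<open>h \<otimes> x [^] i\<close>. \<open>Puniq\<close> makes it single-valued
    and \<open>Pm\<close> makes it multiplicative.\<close>
  define P where "P y z \<longleftrightarrow> (\<exists>h\<in>H. \<exists>i::int. y = h \<otimes> x [^] i \<and> z = \<chi> h * w powi i)" for y z
  have Puniq: "z = z'" if P: "P y z" "P y z'" for y z z'
  proof -
    obtain h i where 1: "h \<in> H" "y = h \<otimes> x [^] i" "z = \<chi> h * w powi (i::int)"
      using P(1) unfolding P_def by blast
    obtain h' j where 2: "h' \<in> H" "y = h' \<otimes> x [^] j" "z' = \<chi> h' * w powi (j::int)"
      using P(2) unfolding P_def by blast
    have c: "h \<in> carrier G" "h' \<in> carrier G" "x [^] i \<in> carrier G" "x [^] j \<in> carrier G"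
      using 1 2 HG x by auto
    \<comment> \<open>Two representations of \<open>y\<close> differ by a power of \<open>x\<close>
      that equals \<open>inv h \<otimes> h'\<close> and so lies in \<open>H\<close>, where
      \<open>powH\<close> applies.\<close>
    have "x [^] (i - j) = x [^] i \<otimes> inv (x [^] j)" using x by (rule int_pow_diff)
    also have "\<dots> = inv h \<otimes> (h \<otimes> x [^] i) \<otimes> inv (x [^] j)"
      using c by (simp add: m_assoc[symmetric])
    also have "\<dots> = inv h \<otimes> (h' \<otimes> x [^] j) \<otimes> inv (x [^] j)" using 1 2 by simp
    also have "\<dots> = inv h \<otimes> h'" using c by (simp add: m_assoc)
    finally have e: "x [^] (i - j) = inv h \<otimes> h'" .
    hence "x [^] (i - j) \<in> H" using 1 2 Hi Hm by simp
    hence "w powi (i - j) = \<chi> (inv h \<otimes> h')" using powH[of "i - j"] e by metis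
    also have "\<dots> = inverse (\<chi> h) * \<chi> h'"
      using 1 2 Hi \<chi>m partial_char_inv[OF H \<chi>] by simp
    finally show ?thesis
      using 1 2 w0 \<chi>0[OF 1(1)] by (simp add: power_int_diff field_simps)
  qed
  have Pm: "P (y \<otimes> y') (z * z')" if P: "P y z" "P y' z'" for y y' z z'
  proof -
    obtain h i where 1: "h \<in> H" "y = h \<otimes> x [^] i" "z = \<chi> h * w powi (i::int)"
      using P(1) unfolding P_def by blast
    obtain h' j where 2: "h' \<in> H" "y' = h' \<otimes> x [^] j" "z' = \<chi> h' * w powi (j::int)"
      using P(2) unfolding P_def by blast
    have c: "h \<in> carrier G" "h' \<in> carrier G" "x [^] i \<in> carrier G" "x [^] j \<in> carrier G"
      using 1 2 HG x by auto
    have "y \<otimes> y' = (h \<otimes> h') \<otimes> x [^] (i + j)"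
      using 1 2 c x by (simp add: int_pow_mult m_ac)
    moreover have "z * z' = \<chi> (h \<otimes> h') * w powi (i + j)"
      using 1 2 \<chi>m w0 by (simp add: power_int_add)
    ultimately show ?thesis using 1 2 Hm unfolding P_def by blast
  qed
  define H' where "H' = {y. \<exists>z. P y z}"
  define \<chi>' where "\<chi>' y = (THE z. P y z)" for y
  have eq: "\<chi>' y = z" if "P y z" for y z
    unfolding \<chi>'_def using that Puniq by blast
  have PH: "P h (\<chi> h)" if "h \<in> H" for h
    unfolding P_def using that HG by (intro bexI[of _ h] exI[of _ 0]) auto
  have Px: "P x w"
    unfolding P_def using H1 x partial_char_one[OF H \<chi>]
    by (intro bexI[of _ "\<one>"] exI[of _ 1]) auto
  have sub: "subgroup H' G"
  proof
    show "H' \<subseteq> carrier G" using HG x by (auto simp: H'_def P_def)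
    show "\<one> \<in> H'" using PH[OF H1] by (auto simp: H'_def)
    show "a \<otimes> b \<in> H'" if "a \<in> H'" "b \<in> H'" for a b
      using that Pm unfolding H'_def by blast
    show "inv a \<in> H'" if a: "a \<in> H'" for a
    proof -
      obtain h i where 1: "h \<in> H" "a = h \<otimes> x [^] (i::int)"
        using a unfolding H'_def P_def by blast
      have "inv a = inv h \<otimes> x [^] (- i)"
        using 1 HG x by (simp add: inv_mult int_pow_neg)
      thus ?thesis using 1(1) Hi unfolding H'_def P_def by blast
    qed
  qed
  have "partial_char G H' \<chi>'"
    unfolding partial_char_def
  proof (intro conjI ballI)
    fix a assume "a \<in> H'"
    then obtain z where z: "P a z" by (auto simp: H'_def)
    hence "z \<noteq> 0" using w0 \<chi>0 by (auto simp: P_def)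
    thus "\<chi>' a \<noteq> 0" using eq z by simp
  next
    fix a b assume "a \<in> H'" "b \<in> H'"
    then obtain z z' where z: "P a z" "P b z'" by (auto simp: H'_def)
    show "\<chi>' (a \<otimes> b) = \<chi>' a * \<chi>' b"
      using eq[OF Pm[OF z]] eq[OF z(1)] eq[OF z(2)] by simp
  qed
  moreover have "H \<subseteq> H'" using PH by (auto simp: H'_def)
  moreover have "x \<in> H'" "\<chi>' x = w" using Px eq by (auto simp: H'_def)
  moreover have "\<forall>h\<in>H. \<chi>' h = \<chi> h" using PH eq by blast
  ultimately show ?thesis using sub by blast
qed

text \<open>Induction on the number of elements outside \<open>H\<close>: any such element can be
  adjoined by \<open>partial_char_extend_step\<close>, which leaves fewer elements outside.\<close>

lemma partial_char_extend:
  assumes "finite (carrier G)" "subgroup H G" "partial_char G H \<chi>"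
  shows "\<exists>\<chi>'. partial_char G (carrier G) \<chi>' \<and> (\<forall>h\<in>H. \<chi>' h = \<chi> h)"
  using assms(2,3)
proof (induction "card (carrier G - H)" arbitrary: H \<chi> rule: less_induct)
  case less
  show ?case
  proof (cases "H = carrier G")
    case True
    thus ?thesis using less.prems by blast
  next
    case False
    then obtain x where x: "x \<in> carrier G" "x \<notin> H"
      using less.prems(1) subgroup.subset by blast
    define k where "k = (LEAST k::nat. 0 < k \<and> x [^] k \<in> H)"
    \<comment> \<open>Some positive power of \<open>x\<close> is \<open>\<one>\<close>, hence in
      \<open>H\<close>, so the least exponent \<open>k\<close> exists.\<close>
    obtain k0 :: nat where "0 < k0" "x [^] k0 = \<one>"
      using finite_pow_eq_one[OF assms(1) x(1)] by blast
    hence "0 < k0 \<and> x [^] k0 \<in> H"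
      using less.prems(1) subgroup.one_closed by fastforce
    hence k: "0 < k \<and> x [^] k \<in> H" unfolding k_def by (rule LeastI)
    have kmin: "x [^] j \<notin> H" if "0 < j" "j < k" for j
      using not_less_Least[of j "\<lambda>k. 0 < k \<and> x [^] k \<in> H"] that by (auto simp: k_def)
    have nz: "\<chi> (x [^] k) \<noteq> 0" using k less.prems(2) unfolding partial_char_def by blast
    \<comment> \<open>A nonzero complex number has exactly \<open>k\<close> roots of order
      \<open>k\<close>, and \<open>k\<close> is positive.\<close>
    have "{z. z ^ k = \<chi> (x [^] k)} \<noteq> {}"
      using card_nth_roots[OF nz, of k] k by fastforce
    then obtain w where w: "w ^ k = \<chi> (x [^] k)" by blast
    obtain H' \<chi>' where H': "subgroup H' G" "H \<subseteq> H'" "x \<in> H'" "partial_char G H' \<chi>'"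
        "\<forall>h\<in>H. \<chi>' h = \<chi> h"
      using partial_char_extend_step[OF less.prems x(1) _ _ kmin w] k by blast
    have "card (carrier G - H') < card (carrier G - H)"
      using x H' assms(1) by (intro psubset_card_mono) auto
    from less.hyps[OF this H'(1,4)] show ?thesis using H'(2,5) by (metis subsetD)
  qed
qed

text \<open>The order \<open>k\<close> of \<open>a\<close> is at least 2, so there is a
  \<open>k\<close>-th root of unity \<open>w\<close> other than 1. Adjoining \<open>a\<close> to the
  trivial subgroup with value \<open>w\<close> and then extending to the whole group gives the
  character.\<close>

lemma exists_separating_char:
  assumes "finite (carrier G)" "a \<in> carrier G" "a \<noteq> \<one>"
  shows "\<exists>\<chi>\<in>characters G. \<chi> a \<noteq> 1"
proof -
  \<comment> \<open>This is the order of \<open>a\<close>, phrased as membership in the trivial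
    subgroup to fit \<open>partial_char_extend_step\<close>.\<close>
  define k where "k = (LEAST k::nat. 0 < k \<and> a [^] k \<in> {\<one>})"
  obtain k0 :: nat where "0 < k0" "a [^] k0 = \<one>"
    using finite_pow_eq_one[OF assms(1,2)] by blast
  hence "0 < k0 \<and> a [^] k0 \<in> {\<one>}" by simp
  hence k: "0 < k \<and> a [^] k \<in> {\<one>}" unfolding k_def by (rule LeastI)
  have kmin: "a [^] j \<notin> {\<one>}" if "0 < j" "j < k" for j
    using not_less_Least[of j "\<lambda>k. 0 < k \<and> a [^] k \<in> {\<one>}"] that by (auto simp: k_def)
  have "k \<noteq> 1" using k assms by auto
  hence k2: "k \<ge> 2" using k by linarith
  have "{z::complex. z ^ k = 1} \<noteq> {1}"
  proof
    assume "{z::complex. z ^ k = 1} = {1}"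
    hence "card {z::complex. z ^ k = 1} = 1" by simp
    thus False using card_roots_unity_eq[of k] k2 by simp
  qed
  moreover have "1 \<in> {z::complex. z ^ k = 1}" by simp
  ultimately obtain w :: complex where w: "w ^ k = 1" "w \<noteq> 1" by blast
  have triv: "subgroup {\<one>} G" by (rule triv_subgroup)
  have pc: "partial_char G {\<one>} (\<lambda>_. 1)" by (simp add: partial_char_def)
  obtain H' \<chi>' where H': "subgroup H' G" "a \<in> H'" "partial_char G H' \<chi>'" "\<chi>' a = w"
    using partial_char_extend_step[OF triv pc assms(2) _ _ kmin] k w by blast
  obtain \<chi> where \<chi>: "partial_char G (carrier G) \<chi>" "\<forall>h\<in>H'. \<chi> h = \<chi>' h"
    using partial_char_extend[OF assms(1) H'(1,3)] by blast
  have "restrict \<chi> (carrier G) \<in> characters G"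
    using \<chi>(1) by (simp add: characters_iff partial_char_def)
  moreover have "restrict \<chi> (carrier G) a \<noteq> 1" using assms \<chi> H' w by simp
  ultimately show ?thesis by blast
qed

section \<open>Orthogonality of the characters of a finite abelian group\<close>

lemma character_mult:
  assumes "\<chi> \<in> characters G" "a \<in> carrier G" "b \<in> carrier G"
  shows "\<chi> (a \<otimes> b) = \<chi> a * \<chi> b"
  using assms by (simp add: characters_iff partial_char_def)

lemma character_one: "\<chi> \<in> characters G \<Longrightarrow> \<chi> \<one> = 1"
  using partial_char_one[OF subgroup_self] by (simp add: characters_iff)

lemma character_root_of_unity:
  assumes "finite (carrier G)" "\<chi> \<in> characters G" "a \<in> carrier G"
  shows "\<chi> a ^ order G = 1"
  using assms partial_char_pow[OF subgroup_self, of \<chi> a "order G"] pow_order_eq_1[of a]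
  by (simp add: characters_iff character_one)

lemma cmod_character:
  assumes "finite (carrier G)" "\<chi> \<in> characters G" "a \<in> carrier G"
  shows "cmod (\<chi> a) = 1"
proof -
  have "order G > 0" using assms(1) by (simp add: order_gt_0_iff_finite)
  moreover have "cmod (\<chi> a) ^ order G = 1"
    using character_root_of_unity[OF assms] by (metis norm_one norm_power)
  ultimately show ?thesis
    using power_eq_imp_eq_base[of "cmod (\<chi> a)" "order G" 1] by simp
qed

text \<open>The values are roots of unity of order dividing \<open>order G\<close>, and
  extensionality fixes the function elsewhere, so all characters lie in a finite function
  space.\<close>

lemma finite_characters:
  assumes "finite (carrier G)"
  shows "finite (characters G)"
proof (rule finite_subset)
  have "order G > 0" using assms(1) by (simp add: order_gt_0_iff_finite)
  thus "finite (PiE (carrier G) (\<lambda>_. {z::complex. z ^ order G = 1}))"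
    using assms by (intro finite_PiE finite_roots_unity) auto
  show "characters G \<subseteq> PiE (carrier G) (\<lambda>_. {z. z ^ order G = 1})"
    using character_root_of_unity[OF assms] by (auto simp: PiE_def characters_iff)
qed

lemma characters_times:
  assumes "\<chi> \<in> characters G" "\<psi> \<in> characters G"
  shows "(\<lambda>a\<in>carrier G. \<chi> a * \<psi> a) \<in> characters G"
  using assms by (simp add: characters_iff partial_char_def)

lemma characters_inverse:
  assumes "\<chi> \<in> characters G"
  shows "(\<lambda>a\<in>carrier G. inverse (\<chi> a)) \<in> characters G"
  using assms by (simp add: characters_iff partial_char_def)

text \<open>Translation by \<open>a\<close> permutes the group but multiplies the sum by
  \<open>\<chi> a\<close>, which differs from 1.\<close>

lemma sum_character_eq_0:
  assumes "finite (carrier G)" "\<chi> \<in> characters G" "a \<in> carrier G" "\<chi> a \<noteq> 1"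
  shows "(\<Sum>g\<in>carrier G. \<chi> g) = 0"
proof -
  have "bij_betw (\<lambda>g. a \<otimes> g) (carrier G) (carrier G)"
    by (rule bij_betwI[where g = "\<lambda>g. inv a \<otimes> g"])
      (use assms in \<open>auto simp: m_assoc[symmetric]\<close>)
  hence "(\<Sum>g\<in>carrier G. \<chi> g) = (\<Sum>g\<in>carrier G. \<chi> (a \<otimes> g))"
    by (rule sum.reindex_bij_betw[symmetric])
  also have "\<dots> = \<chi> a * (\<Sum>g\<in>carrier G. \<chi> g)"
    using assms by (simp add: character_mult sum_distrib_left)
  finally show ?thesis using assms(4) by simp
qed

text \<open>The dual argument: multiplication by a character \<open>\<psi>\<close> with
  \<open>\<psi> a \<noteq> 1\<close> permutes the characters and multiplies the sum by
  \<open>\<psi> a\<close>. This is where separation of points enters.\<close>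

lemma sum_characters_eq_0:
  assumes "finite (carrier G)" "a \<in> carrier G" "a \<noteq> \<one>"
  shows "(\<Sum>\<chi>\<in>characters G. \<chi> a) = 0"
proof -
  obtain \<psi> where \<psi>: "\<psi> \<in> characters G" "\<psi> a \<noteq> 1"
    using exists_separating_char[OF assms] by blast
  have nz: "\<psi> b \<noteq> 0" if "b \<in> carrier G" for b
    using \<psi>(1) that by (simp add: characters_iff partial_char_def)
  have "bij_betw (\<lambda>\<chi>. \<lambda>a\<in>carrier G. \<psi> a * \<chi> a) (characters G) (characters G)"
  proof (rule bij_betwI[where g = "\<lambda>\<chi>. \<lambda>a\<in>carrier G. inverse (\<psi> a) * \<chi> a"])
    show "(\<lambda>\<chi>. \<lambda>a\<in>carrier G. \<psi> a * \<chi> a) \<in> characters G \<rightarrow> characters G"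
      using characters_times[OF \<psi>(1)] by blast
    show "(\<lambda>\<chi>. \<lambda>a\<in>carrier G. inverse (\<psi> a) * \<chi> a) \<in> characters G \<rightarrow> characters G"
      using characters_times[OF characters_inverse[OF \<psi>(1)]] by (simp cong: restrict_cong)
  next
    fix \<chi> assume "\<chi> \<in> characters G"
    hence "\<chi> \<in> extensional (carrier G)" by (simp add: characters_iff)
    thus "(\<lambda>a\<in>carrier G. inverse (\<psi> a) * (\<lambda>a\<in>carrier G. \<psi> a * \<chi> a) a) = \<chi>"
      "(\<lambda>a\<in>carrier G. \<psi> a * (\<lambda>a\<in>carrier G. inverse (\<psi> a) * \<chi> a) a) = \<chi>"
      using nz by (auto simp: fun_eq_iff restrict_def extensional_def)
  qed
  hence "(\<Sum>\<chi>\<in>characters G. \<chi> a) =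
      (\<Sum>\<chi>\<in>characters G. (\<lambda>a\<in>carrier G. \<psi> a * \<chi> a) a)"
    by (rule sum.reindex_bij_betw[symmetric])
  also have "\<dots> = \<psi> a * (\<Sum>\<chi>\<in>characters G. \<chi> a)"
    using assms(2) by (simp add: sum_distrib_left)
  finally show ?thesis using \<psi>(2) by simp
qed

text \<open>Both sides equal the sum of \<open>\<chi> a\<close> over all pairs \<open>(\<chi>, a)\<close>, evaluated in the two orders.\<close>

lemma card_characters:
  assumes "finite (carrier G)"
  shows "card (characters G) = order G"
proof -
  define triv :: "'a \<Rightarrow> complex" where "triv = (\<lambda>a\<in>carrier G. 1)"
  have triv: "triv \<in> characters G"
    by (simp add: characters_iff partial_char_def triv_def)
  have "(\<Sum>a\<in>carrier G. \<Sum>\<chi>\<in>characters G. \<chi> a)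
      = (\<Sum>a\<in>carrier G. if a = \<one> then of_nat (card (characters G)) else 0)"
  proof (intro sum.cong refl)
    fix a assume "a \<in> carrier G"
    moreover have "(\<Sum>\<chi>\<in>characters G. \<chi> \<one>) = (\<Sum>\<chi>\<in>characters G. 1)"
      using character_one by (intro sum.cong) auto
    ultimately show "(\<Sum>\<chi>\<in>characters G. \<chi> a)
        = (if a = \<one> then of_nat (card (characters G)) else 0)"
      using sum_characters_eq_0[OF assms] by simp
  qed
  also have "\<dots> = of_nat (card (characters G))"
    using assms by (simp add: sum.delta)
  finally have 1: "(\<Sum>a\<in>carrier G. \<Sum>\<chi>\<in>characters G. \<chi> a) = of_nat (card (characters G))" .
  have "(\<Sum>\<chi>\<in>characters G. \<Sum>a\<in>carrier G. \<chi> a)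
      = (\<Sum>\<chi>\<in>characters G. if \<chi> = triv then of_nat (order G) else 0)"
  proof (intro sum.cong refl)
    fix \<chi> assume \<chi>: "\<chi> \<in> characters G"
    show "(\<Sum>a\<in>carrier G. \<chi> a) = (if \<chi> = triv then of_nat (order G) else 0)"
    proof (cases "\<chi> = triv")
      case True
      thus ?thesis by (simp add: triv_def order_def)
    next
      case False
      \<comment> \<open>Both functions are extensional, so they can only differ at a point of the
        group.\<close>
      then obtain a where "a \<in> carrier G" "\<chi> a \<noteq> 1"
        using \<chi> by (auto simp: triv_def characters_iff fun_eq_iff extensional_def split: if_splits)
      thus ?thesis using sum_character_eq_0[OF assms \<chi>] False by simp
    qed
  qed
  also have "\<dots> = of_nat (order G)"
    using finite_characters[OF assms] triv by (simp add: sum.delta)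
  finally have "(of_nat (card (characters G)) :: complex) = of_nat (order G)"
    using 1 sum.swap[of "\<lambda>a \<chi>. \<chi> a" "characters G" "carrier G"] by simp
  thus ?thesis by (simp only: of_nat_eq_iff)
qed

text \<open>Character values have modulus 1, so conjugation is inversion and the summand is
  \<open>\<chi> (inv a \<otimes> b)\<close>. The sum then vanishes unless
  \<open>inv a \<otimes> b\<close> is the identity, when it counts the characters.\<close>

lemma characters_orthogonal:
  assumes "finite (carrier G)" "a \<in> carrier G" "b \<in> carrier G"
  shows "(\<Sum>\<chi>\<in>characters G. cnj (\<chi> a) * \<chi> b) = (if a = b then of_nat (order G) else 0)"
proof -
  have "cnj (\<chi> a) * \<chi> b = \<chi> (inv a \<otimes> b)" if \<chi>: "\<chi> \<in> characters G" for \<chi>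
  proof -
    have "\<chi> (inv a \<otimes> b) = \<chi> (inv a) * \<chi> b" using \<chi> assms by (simp add: character_mult)
    also have "\<chi> (inv a) = inverse (\<chi> a)"
      using partial_char_inv[OF subgroup_self] \<chi> assms by (simp add: characters_iff)
    also have "\<dots> = cnj (\<chi> a)"
      using cmod_character[OF assms(1) \<chi> assms(2)]
      by (simp add: inverse_unique complex_norm_square[symmetric])
    finally show ?thesis by simp
  qed
  hence eq: "(\<Sum>\<chi>\<in>characters G. cnj (\<chi> a) * \<chi> b) = (\<Sum>\<chi>\<in>characters G. \<chi> (inv a \<otimes> b))"
    by simp
  show ?thesis
  proof (cases "a = b")
    case True
    thus ?thesis using eq assms card_characters[OF assms(1)] by (simp add: character_one)
  next
    case False
    hence "inv a \<otimes> b \<noteq> \<one>"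
      using assms by (metis inv_equality inv_inv l_inv inv_closed)
    thus ?thesis using eq assms sum_characters_eq_0[OF assms(1)] False by simp
  qed
qed

end

section \<open>Logarithmic derivatives and roots of unity\<close>

text \<open>The product rule, one linear factor at a time; all divisions are genuine because
  \<open>z\<close> is not a root.\<close>

lemma logderiv_prod_linear:
  fixes f :: "'a \<Rightarrow> complex"
  assumes "finite A" "\<And>a. a \<in> A \<Longrightarrow> z \<noteq> f a"
  shows "poly (pderiv (\<Prod>a\<in>A. [:- f a, 1:])) z / poly (\<Prod>a\<in>A. [:- f a, 1:]) z
           = (\<Sum>a\<in>A. 1 / (z - f a))"
  using assms
proof (induction A rule: finite_induct)
  case (insert x A)
  have step: "poly (pderiv ([:- c, 1:] * q)) z = (z - c) * poly (pderiv q) z + poly q z"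
    "poly ([:- c, 1:] * q) z = (z - c) * poly q z" for c :: complex and q
    by (simp_all only: pderiv_mult poly_mult poly_add) (simp_all add: pderiv_pCons algebra_simps)
  have nz: "poly (\<Prod>a\<in>A. [:- f a, 1:]) z \<noteq> 0" "z - f x \<noteq> 0"
    using insert by (auto simp: poly_prod)
  have "poly (pderiv (\<Prod>a\<in>insert x A. [:- f a, 1:])) z / poly (\<Prod>a\<in>insert x A. [:- f a, 1:]) z
      = ((z - f x) * poly (pderiv (\<Prod>a\<in>A. [:- f a, 1:])) z + poly (\<Prod>a\<in>A. [:- f a, 1:]) z)
          / ((z - f x) * poly (\<Prod>a\<in>A. [:- f a, 1:]) z)"
    unfolding prod.insert[OF insert(1,2)] step ..
  also have "\<dots> = 1 / (z - f x)
      + poly (pderiv (\<Prod>a\<in>A. [:- f a, 1:])) z / poly (\<Prod>a\<in>A. [:- f a, 1:]) z"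
    using nz by (simp add: add_divide_distrib)
  also have "\<dots> = (\<Sum>a\<in>insert x A. 1 / (z - f a))"
    using insert by simp
  finally show ?case .
qed simp

abbreviation exp_root :: "nat \<Rightarrow> nat \<Rightarrow> complex" where
  "exp_root k j \<equiv> exp (2 * of_real pi * \<i> * of_nat j / of_nat k)"

lemma exp_root_eq_cis: "exp_root k j = cis (2 * pi * real j / real k)"
  by (simp add: cis_conv_exp mult_ac)

lemma exp_root_pow: "k > 0 \<Longrightarrow> exp_root k j ^ k = 1"
  by (simp add: exp_root_eq_cis DeMoivre cis_multiple_2pi)

lemma exp_root_mult_left: "d > 0 \<Longrightarrow> k > 0 \<Longrightarrow> exp_root (d * k) (d * j) = exp_root k j"
  by (simp add: field_simps)

text \<open>Both sides are monic of degree \<open>k\<close> and vanish at all \<open>k\<close> roots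
  of unity of order dividing \<open>k\<close>; agreement at \<open>k\<close> points together with
  equal leading coefficients forces equality.\<close>

lemma prod_exp_root:
  assumes "k > 0"
  shows "(\<Prod>j\<in>{1..k}. [:- exp_root k j, 1:]) = Polynomial.monom 1 k - 1"
proof -
  define Z where "Z = {z::complex. z ^ k = 1}"
  have Z: "finite Z" "card Z = k"
    unfolding Z_def using assms finite_roots_unity[of k] card_roots_unity_eq by auto
  \<comment> \<open>The library parametrises the roots by \<open>{..<k}\<close> rather than
    \<open>{1..k}\<close>; the indices \<open>k\<close> and 0 give the same root 1.\<close>
  have "{1..k} = insert k {1..<k}" "{..<k} = insert 0 {1..<k}" using assms by auto
  moreover have "exp_root k k = exp_root k 0"
    using assms by (simp add: exp_root_eq_cis)
  ultimately have "(\<Prod>j\<in>{1..k}. [:- exp_root k j, 1:]) = (\<Prod>j<k. [:- exp_root k j, 1:])"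
    by simp
  also have "\<dots> = (\<Prod>z\<in>Z. [:- z, 1:])"
    unfolding exp_root_eq_cis Z_def
    by (rule prod.reindex_bij_betw[OF bij_betw_roots_unity[OF assms], of "\<lambda>z. [:- z, 1:]"])
  also have "\<dots> = Polynomial.monom 1 k - 1"
  proof (rule poly_eqI_degree_lead_coeff[where n = k and A = Z])
    have deg: "degree (\<Prod>z\<in>Z. [:- z, 1:]) = k"
      using Z by (simp add: degree_prod_eq_sum_degree)
    have "lead_coeff (\<Prod>z\<in>Z. [:- z, 1:]) = 1" by (simp add: lead_coeff_prod)
    thus "poly.coeff (\<Prod>z\<in>Z. [:- z, 1:]) k = poly.coeff (Polynomial.monom 1 k - 1) k"
      using assms deg by (simp add: coeff_1)
    show "degree (\<Prod>z\<in>Z. [:- z, 1:]) \<le> k" using deg by simp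
    show "degree (Polynomial.monom 1 k - 1 :: complex poly) \<le> k"
      by (intro degree_diff_le degree_monom_le) simp
    show "poly (\<Prod>z\<in>Z. [:- z, 1:]) z = poly (Polynomial.monom 1 k - 1) z" if "z \<in> Z" for z
    proof -
      have "poly (\<Prod>z\<in>Z. [:- z, 1:]) z = 0"
        using that Z by (auto simp: poly_prod)
      thus ?thesis using that by (simp add: Z_def poly_monom)
    qed
  qed (use Z in simp)
  finally show ?thesis .
qed

text \<open>The logarithmic derivative of \<open>X^k - 1\<close> at \<open>z\<close>, computed once
  from its linear factors and once from its closed form.\<close>

lemma sum_exp_root:
  assumes "k > 0" "z ^ k \<noteq> 1"
  shows "(\<Sum>j\<in>{1..k}. 1 / (z - exp_root k j)) = of_nat k * z ^ (k - 1) / (z ^ k - 1)"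
proof -
  have "z \<noteq> exp_root k j" for j using assms exp_root_pow by metis
  hence "(\<Sum>j\<in>{1..k}. 1 / (z - exp_root k j))
      = poly (pderiv (Polynomial.monom 1 k - 1)) z / poly (Polynomial.monom 1 k - 1) z"
    using logderiv_prod_linear[of "{1..k}" z "exp_root k"] prod_exp_root[OF assms(1)] by simp
  thus ?thesis by (simp add: pderiv_diff pderiv_monom poly_monom)
qed

section \<open>Inclusion-exclusion over sets of prime factors\<close>

lemma prod_primes_dvd_iff:
  fixes S :: "nat set"
  assumes "finite S" "\<And>p. p \<in> S \<Longrightarrow> prime p"
  shows "\<Prod>S dvd j \<longleftrightarrow> (\<forall>p\<in>S. p dvd j)"
  using assms
proof (induction S rule: finite_induct)
  case (insert p S)
  have "coprime p (\<Prod>S)"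
    using insert by (intro prod_coprime_right) (auto intro: primes_coprime)
  hence "p * \<Prod>S dvd j \<longleftrightarrow> p dvd j \<and> \<Prod>S dvd j"
    by (metis divides_mult dvd_mult_left dvd_mult_right)
  thus ?case using insert by simp
qed simp

lemma coprime_iff_prime_factors:
  assumes "n > (0::nat)"
  shows "coprime j n \<longleftrightarrow> (\<forall>p\<in>prime_factors n. \<not> p dvd j)"
proof
  assume "coprime j n"
  thus "\<forall>p\<in>prime_factors n. \<not> p dvd j"
    using assms coprime_common_divisor not_prime_unit by (auto simp: prime_factors_dvd)
next
  assume *: "\<forall>p\<in>prime_factors n. \<not> p dvd j"
  show "coprime j n"
  proof (rule ccontr)
    assume "\<not> coprime j n"
    hence "gcd j n \<noteq> 1" using coprime_iff_gcd_eq_1 by blast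
    then obtain p where "prime p" "p dvd gcd j n" using prime_factor_nat by blast
    thus False using * assms by (auto simp: prime_factors_dvd)
  qed
qed

text \<open>The indicator is the product over primes \<open>p\<close> dividing \<open>n\<close> of
  one minus the indicator of \<open>p dvd j\<close>. Expanding gives a signed sum over sets
  \<open>S\<close> of primes, all of which divide \<open>j\<close> exactly when their product
  does.\<close>

lemma coprime_indicator_eq_sum:
  assumes "n > (0::nat)"
  shows "(if coprime j n then 1 else 0 :: complex) =
    (\<Sum>S\<in>Pow (prime_factors n). (- 1) ^ card S * (if \<Prod>S dvd j then 1 else 0))"
proof -
  have "(if coprime j n then 1 else 0 :: complex)
      = (\<Prod>p\<in>prime_factors n. 1 - (if p dvd j then 1 else 0))"
    using coprime_iff_prime_factors[OF assms, of j] by (auto intro!: prod.neutral[symmetric])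
  also have "\<dots> = (\<Sum>S\<in>Pow (prime_factors n). (- 1) ^ card S * (\<Prod>p\<in>S. if p dvd j then 1 else 0))"
    by (subst prod_diff_conv_sum) simp_all
  also have "\<dots> = (\<Sum>S\<in>Pow (prime_factors n). (- 1) ^ card S * (if \<Prod>S dvd j then 1 else 0))"
  proof (intro sum.cong refl arg_cong2[where f = "(*)"])
    fix S assume "S \<in> Pow (prime_factors n)"
    hence S: "finite S" "\<And>p. p \<in> S \<Longrightarrow> prime p"
      by (auto intro: finite_subset dest: in_prime_factors_imp_prime)
    show "(\<Prod>p\<in>S. if p dvd j then 1 else 0 :: complex) = (if \<Prod>S dvd j then 1 else 0)"
      using prod_primes_dvd_iff[OF S, of j] S(1) by (auto intro!: prod.neutral)
  qed
  finally show ?thesis .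
qed

lemma prod_subset_prime_factors_dvd:
  assumes "n > (0::nat)" "S \<subseteq> prime_factors n"
  shows "\<Prod>S dvd n"
proof -
  have "finite S" using assms(2) by (rule finite_subset) simp
  thus ?thesis
    using prod_primes_dvd_iff[of S n] assms in_prime_factors_imp_prime in_prime_factors_imp_dvd by blast
qed

text \<open>Applied with \<open>n = d * k\<close>: among the \<open>n\<close>-th roots of unity, the
  indices divisible by \<open>d\<close> single out the \<open>k\<close>-th roots.\<close>

lemma sum_multiples:
  fixes g :: "nat \<Rightarrow> complex"
  assumes "d > 0"
  shows "(\<Sum>j\<in>{1..d * k}. if d dvd j then g j else 0) = (\<Sum>i\<in>{1..k}. g (d * i))"
proof -
  have "(\<Sum>j\<in>{1..d * k}. if d dvd j then g j else 0) = (\<Sum>j | j \<in> {1..d * k} \<and> d dvd j. g j)"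
    by (rule sum.inter_filter[symmetric]) simp
  also have "\<dots> = (\<Sum>i\<in>{1..k}. g (d * i))"
    using assms
    by (intro sum.reindex_bij_witness[of _ "\<lambda>i. d * i" "\<lambda>j. j div d"])
       (auto simp: Suc_le_eq elim!: dvdE)
  finally show ?thesis .
qed

text \<open>Moebius inversion of \<open>X^n - 1 = \<Prod>d dvd n. \<Phi>\<^sub>d\<close>, with the squarefree divisors of \<open>n\<close> indexed by
  their sets \<open>S\<close> of prime factors.\<close>

lemma cyclotomic_logderiv_eq_sum:
  assumes "n > 0" "z ^ n \<noteq> 1"
  shows "cyclotomic_logderiv n z =
    (\<Sum>S\<in>Pow (prime_factors n). (- 1) ^ card S *
       (of_nat (n div \<Prod>S) * z ^ (n div \<Prod>S - 1) / (z ^ (n div \<Prod>S) - 1)))"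
proof -
  define g where "g j = 1 / (z - exp_root n j)" for j
  have "z \<noteq> exp_root n j" for j using assms exp_root_pow by metis
  hence "cyclotomic_logderiv n z = (\<Sum>j\<in>{j\<in>{1..n}. coprime j n}. g j)"
    unfolding cyclotomic_logderiv_def cyclotomic_poly_def g_def
    by (intro logderiv_prod_linear) auto
  also have "\<dots> = (\<Sum>j\<in>{1..n}. (if coprime j n then 1 else 0) * g j)"
    by (subst sum.inter_filter) (auto intro!: sum.cong)
  also have "\<dots> = (\<Sum>j\<in>{1..n}. \<Sum>S\<in>Pow (prime_factors n).
      (- 1) ^ card S * (if \<Prod>S dvd j then g j else 0))"
    unfolding coprime_indicator_eq_sum[OF assms(1)] sum_distrib_right
    by (intro sum.cong refl) simp
  also have "\<dots> = (\<Sum>S\<in>Pow (prime_factors n). (- 1) ^ card S *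
      (\<Sum>j\<in>{1..n}. if \<Prod>S dvd j then g j else 0))"
    unfolding sum_distrib_left by (rule sum.swap)
  also have "\<dots> = (\<Sum>S\<in>Pow (prime_factors n). (- 1) ^ card S *
       (of_nat (n div \<Prod>S) * z ^ (n div \<Prod>S - 1) / (z ^ (n div \<Prod>S) - 1)))"
  proof (intro sum.cong refl arg_cong2[where f = "(*)"])
    fix S assume "S \<in> Pow (prime_factors n)"
    hence "\<Prod>S dvd n" using prod_subset_prime_factors_dvd[OF assms(1)] by blast
    then obtain k where k: "n = \<Prod>S * k" by (elim dvdE)
    define d where "d = \<Prod>S"
    have n: "n = d * k" "d > 0" "k > 0" using k assms(1) by (auto simp: d_def intro: Nat.gr0I)
    \<comment> \<open>As \<open>k\<close> divides \<open>n\<close>, a \<open>k\<close>-th root of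
      unity would also be an \<open>n\<close>-th root of unity.\<close>
    have "z ^ k \<noteq> 1" using assms(2) n by (metis mult.commute power_mult power_one)
    hence "(\<Sum>j\<in>{1..n}. if d dvd j then g j else 0) = of_nat k * z ^ (k - 1) / (z ^ k - 1)"
      using n sum_multiples[OF n(2), of g k] sum_exp_root[OF n(3), of z]
      by (simp add: g_def exp_root_mult_left[OF n(2,3)] del: of_nat_mult)
    thus "(\<Sum>j\<in>{1..n}. if \<Prod>S dvd j then g j else 0)
        = of_nat (n div \<Prod>S) * z ^ (n div \<Prod>S - 1) / (z ^ (n div \<Prod>S) - 1)"
      using n by (simp add: d_def)
  qed
  finally show ?thesis .
qed

section \<open>The unit group modulo \<open>m\<close> and its Dirichlet characters\<close>

lemma dual_group_eq_characters: "dual_group m = characters (residue_units m)"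
  by (simp add: dual_group_def characters_def)

lemma
  assumes "m > 1"
  shows comm_group_residue_units: "comm_group (residue_units m)"
    and carrier_residue_units:
      "carrier (residue_units m) = {x. 0 < x \<and> x < int m \<and> coprime x (int m)}"
    and mult_residue_units: "x \<otimes>\<^bsub>residue_units m\<^esub> y = x * y mod int m"
proof -
  interpret residues "int m" "residue_ring (int m)"
    by unfold_locales (use assms in auto)
  show "comm_group (residue_units m)"
    unfolding residue_units_def by (rule units_comm_group)
  show "carrier (residue_units m) = {x. 0 < x \<and> x < int m \<and> coprime x (int m)}"
    using res_units_eq by (simp add: residue_units_def units_of_def)
  show "x \<otimes>\<^bsub>residue_units m\<^esub> y = x * y mod int m"
    by (simp add: residue_units_def units_of_def res_mult_eq)
qed

lemma finite_residue_units: "m > 1 \<Longrightarrow> finite (carrier (residue_units m))"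
  by (rule finite_subset[of _ "{0..int m}"]) (auto simp: carrier_residue_units)

lemma order_residue_units:
  assumes "m > 1"
  shows "order (residue_units m) = totient m"
proof -
  have "carrier (residue_units m) = int ` totatives m"
  proof (intro equalityI subsetI)
    fix x assume "x \<in> carrier (residue_units m)"
    hence x: "0 < x" "x < int m" "coprime x (int m)"
      unfolding carrier_residue_units[OF assms] by blast+
    have "x = int (nat x)" using x(1) by simp
    moreover from this have "coprime (nat x) m" using x(3) coprime_int_iff by metis
    ultimately have "x = int (nat x)" "nat x \<in> totatives m"
      using x(1,2) by (auto simp: totatives_def)
    thus "x \<in> int ` totatives m" by blast
  next
    fix x assume "x \<in> int ` totatives m"
    thus "x \<in> carrier (residue_units m)"
      using assms totatives_less by (auto simp: carrier_residue_units totatives_def)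
  qed
  thus ?thesis by (simp add: order_def totient_def card_image)
qed

lemma mod_in_residue_units:
  assumes "m > 1" "coprime k m"
  shows "int k mod int m \<in> carrier (residue_units m)"
proof -
  have "coprime (int k mod int m) (int m)" using assms by simp
  moreover have "int k mod int m \<noteq> 0"
  proof
    assume "int k mod int m = 0"
    hence "m dvd k" by (metis mod_0_imp_dvd int_dvd_int_iff)
    thus False using assms by (metis coprime_absorb_right nat_dvd_1_iff_1 less_irrefl coprime_def dvd_refl)
  qed
  ultimately show ?thesis
    using assms pos_mod_sign[of "int m" "int k"] pos_mod_bound[of "int m" "int k"]
    by (simp add: carrier_residue_units del: pos_mod_sign pos_mod_bound)
qed

lemma char_at_mult:
  assumes "m > 1" "\<psi> \<in> dual_group m" "coprime a m" "coprime b m"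
  shows "char_at m \<psi> (a * b) = char_at m \<psi> a * char_at m \<psi> b"
proof -
  have "\<psi> ((int a mod int m) \<otimes>\<^bsub>residue_units m\<^esub> (int b mod int m))
      = \<psi> (int a mod int m) * \<psi> (int b mod int m)"
    using assms mod_in_residue_units
    by (intro comm_group.character_mult[OF comm_group_residue_units[OF assms(1)]])
       (auto simp: dual_group_eq_characters)
  thus ?thesis
    using assms by (simp add: char_at_def mult_residue_units mod_mult_eq)
qed

lemma char_at_1: "m > 1 \<Longrightarrow> \<psi> \<in> dual_group m \<Longrightarrow> char_at m \<psi> 1 = 1"
proof -
  assume m: "m > 1" and \<psi>: "\<psi> \<in> dual_group m"
  have "char_at m \<psi> 1 = char_at m \<psi> 1 * char_at m \<psi> 1"
    using char_at_mult[OF m \<psi>, of 1 1] by simp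
  moreover have "char_at m \<psi> 1 \<noteq> 0"
    using \<psi> mod_in_residue_units[OF m, of 1]
    by (simp add: char_at_def dual_group_eq_characters characters_iff partial_char_def)
  ultimately show ?thesis by simp
qed

lemma char_at_mult_cnj:
  assumes "m > 1" "\<psi> \<in> dual_group m" "coprime a m"
  shows "char_at m \<psi> a * cnj (char_at m \<psi> a) = 1"
proof -
  have "cmod (char_at m \<psi> a) = 1"
    using comm_group.cmod_character[OF comm_group_residue_units finite_residue_units]
      assms mod_in_residue_units by (simp add: dual_group_eq_characters char_at_def)
  thus ?thesis by (simp add: complex_norm_square[symmetric])
qed

lemma char_at_prod:
  assumes "m > 1" "\<psi> \<in> dual_group m" "finite S" "\<And>p. p \<in> S \<Longrightarrow> coprime p m"
  shows "char_at m \<psi> (\<Prod>S) = (\<Prod>p\<in>S. char_at m \<psi> p)"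
  using assms(3,4)
proof (induction S rule: finite_induct)
  case empty
  show ?case using char_at_1[OF assms(1,2)] by simp
next
  case (insert p S)
  have "coprime (\<Prod>S) m" using insert by (intro prod_coprime_left) auto
  thus ?case using insert char_at_mult[OF assms(1,2)] by simp
qed

section \<open>Character sums and the formula for the logarithmic derivative\<close>

text \<open>Fourier inversion on the unit group: after exchanging the sums, orthogonality keeps only
  the term of \<open>char_coeff\<close> at the class of \<open>k\<close>.\<close>

lemma sum_char_coeff:
  assumes "m > 1" "coprime k m" "\<xi> ^ m = 1"
  shows "(\<Sum>\<psi>\<in>dual_group m. char_coeff m \<psi> \<xi> * char_at m \<psi> k)
    = of_nat (totient m) * (inverse \<xi> * \<xi> ^ k / (1 - \<xi> ^ k))"
proof -
  define h where "h g = inverse \<xi> * \<xi> ^ nat g / (1 - \<xi> ^ nat g)" for g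
  define a where "a = int k mod int m"
  have a: "a \<in> carrier (residue_units m)"
    unfolding a_def using assms mod_in_residue_units by blast
  have fin: "finite (carrier (residue_units m))" using assms finite_residue_units by blast
  \<comment> \<open>Since \<open>\<xi> ^ m = 1\<close>, the representative of the class of
    \<open>k\<close> may be replaced by \<open>k\<close> itself.\<close>
  have "\<xi> ^ nat a = \<xi> ^ (k mod m)" by (simp add: a_def nat_mod_distrib)
  also have "\<dots> = \<xi> ^ k"
    using assms(3) by (metis mult_div_mod_eq mult_1 power_add power_mult power_one)
  finally have \<xi>a: "\<xi> ^ nat a = \<xi> ^ k" .
  have "(\<Sum>\<psi>\<in>dual_group m. char_coeff m \<psi> \<xi> * char_at m \<psi> k)
      = (\<Sum>\<psi>\<in>dual_group m. \<Sum>g\<in>carrier (residue_units m). h g * (cnj (\<psi> g) * \<psi> a))"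
    using assms(2) by (simp add: char_coeff_def char_at_def h_def a_def sum_distrib_right mult.assoc)
  also have "\<dots> = (\<Sum>g\<in>carrier (residue_units m). h g * (\<Sum>\<psi>\<in>dual_group m. cnj (\<psi> g) * \<psi> a))"
    unfolding sum_distrib_left by (rule sum.swap)
  also have "\<dots> = (\<Sum>g\<in>carrier (residue_units m). if g = a then h g * of_nat (totient m) else 0)"
    using comm_group.characters_orthogonal[OF comm_group_residue_units[OF assms(1)] fin _ a]
    by (intro sum.cong refl)
       (simp add: dual_group_eq_characters order_residue_units[OF assms(1)])
  also have "\<dots> = h a * of_nat (totient m)" using fin a by (simp add: sum.delta)
  finally show ?thesis by (simp add: h_def \<xi>a)
qed

text \<open>Each term of the expanded Euler product carries the conjugate value at
  \<open>d = \<Prod>S\<close>. As \<open>d\<close> is coprime to \<open>m\<close>, this conjugate is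
  an inverse and cancels the factor \<open>d\<close> of \<open>n\<close> inside the
  character.\<close>

lemma char_at_mult_prod:
  assumes "n > 0" "m > 1" "coprime n m" "\<psi> \<in> dual_group m"
  shows "char_at m \<psi> n * (\<Prod>p\<in>prime_factors n. 1 - cnj (char_at m \<psi> p) / of_nat p)
    = (\<Sum>S\<in>Pow (prime_factors n). (- 1) ^ card S / of_nat (\<Prod>S) * char_at m \<psi> (n div \<Prod>S))"
proof -
  have "char_at m \<psi> n * (\<Prod>p\<in>prime_factors n. 1 - cnj (char_at m \<psi> p) / of_nat p)
      = (\<Sum>S\<in>Pow (prime_factors n). char_at m \<psi> n *
           ((- 1) ^ card S * (\<Prod>p\<in>S. cnj (char_at m \<psi> p) / of_nat p)))"
    by (subst prod_diff_conv_sum) (simp_all add: sum_distrib_left)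
  also have "\<dots> = (\<Sum>S\<in>Pow (prime_factors n).
      (- 1) ^ card S / of_nat (\<Prod>S) * char_at m \<psi> (n div \<Prod>S))"
  proof (intro sum.cong refl)
    fix S assume S: "S \<in> Pow (prime_factors n)"
    hence fin: "finite S" by (auto intro: finite_subset)
    have "\<Prod>S dvd n" using S prod_subset_prime_factors_dvd[OF assms(1)] by blast
    then obtain k where k: "n = \<Prod>S * k" by (elim dvdE)
    define d where "d = \<Prod>S"
    have n: "n = d * k" "d > 0" using k assms(1) by (auto simp: d_def intro: Nat.gr0I)
    have cop: "coprime d m" "coprime k m" using assms(3) n by auto
    have "coprime p m" if "p \<in> S" for p
      using that S assms(3) coprime_divisors[of p n m m] in_prime_factors_imp_dvd[of p n] by auto
    hence "(\<Prod>p\<in>S. cnj (char_at m \<psi> p) / of_nat p) = cnj (char_at m \<psi> d) / of_nat d"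
      using char_at_prod[OF assms(2,4) fin] by (simp add: d_def prod_dividef)
    hence "char_at m \<psi> n * ((- 1) ^ card S * (\<Prod>p\<in>S. cnj (char_at m \<psi> p) / of_nat p))
        = (- 1) ^ card S / of_nat d * (char_at m \<psi> d * cnj (char_at m \<psi> d)) * char_at m \<psi> k"
      using n char_at_mult[OF assms(2,4) cop] by simp
    also have "\<dots> = (- 1) ^ card S / of_nat d * char_at m \<psi> (n div d)"
      using n char_at_mult_cnj[OF assms(2,4) cop(1)] by simp
    finally show "char_at m \<psi> n * ((- 1) ^ card S * (\<Prod>p\<in>S. cnj (char_at m \<psi> p) / of_nat p))
        = (- 1) ^ card S / of_nat (\<Prod>S) * char_at m \<psi> (n div \<Prod>S)"
      by (simp add: d_def)
  qed
  finally show ?thesis .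
qed

theorem theorem3:
  fixes n m :: nat and \<xi> :: complex
  assumes "n > 1" and "m > 1" and "coprime n m"
    and "primitive_root_of_unity m \<xi>"
  shows "cyclotomic_logderiv n \<xi> =
    - (of_nat n / of_nat (totient m)) *
      (\<Sum>\<psi>\<in>dual_group m. char_coeff m \<psi> \<xi> * char_at m \<psi> n *
        (\<Prod>p\<in>prime_factors n. 1 - cnj (char_at m \<psi> p) / of_nat p))"
proof -
  define P where "P = Pow (prime_factors n)"
  define k where "k S = n div \<Prod>S" for S
  have \<xi>m: "\<xi> ^ m = 1" and prim: "\<And>j. 0 < j \<Longrightarrow> j < m \<Longrightarrow> \<xi> ^ j \<noteq> 1"
    using assms(4) by (auto simp: primitive_root_of_unity_def)
  have \<xi>0: "\<xi> \<noteq> 0" using \<xi>m assms(2) by (auto simp: power_0_left)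
  \<comment> \<open>\<open>\<xi>\<close> has exact order \<open>m\<close>, so equality would make
    \<open>m\<close> divide \<open>n\<close>, against coprimality and \<open>m > 1\<close>. Hence
    \<open>\<xi>\<close> is not a root of the cyclotomic polynomial.\<close>
  have \<xi>n: "\<xi> ^ n \<noteq> 1"
  proof
    assume "\<xi> ^ n = 1"
    moreover have "\<xi> ^ n = \<xi> ^ (n mod m)"
      using \<xi>m by (metis mult_div_mod_eq mult_1 power_add power_mult power_one)
    ultimately have "n mod m = 0"
      using prim[of "n mod m"] assms(2) by fastforce
    thus False using assms(2,3) by (metis coprime_absorb_right dvd_eq_mod_eq_0 less_irrefl nat_dvd_1_iff_1)
  qed
  have tot: "totient m > 0" using assms(2) by simp
  \<comment> \<open>The two expansions over \<open>S\<close> are matched term by term.\<close>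
  have summand: "- (of_nat n / of_nat (totient m)) * ((- 1) ^ card S / of_nat (\<Prod>S) *
        (\<Sum>\<psi>\<in>dual_group m. char_coeff m \<psi> \<xi> * char_at m \<psi> (k S)))
      = (- 1) ^ card S * (of_nat (k S) * \<xi> ^ (k S - 1) / (\<xi> ^ k S - 1))" if "S \<in> P" for S
  proof -
    have "\<Prod>S dvd n" using that prod_subset_prime_factors_dvd[of n S] assms(1) by (auto simp: P_def)
    hence nk: "n = \<Prod>S * k S" by (simp add: k_def)
    define d where "d = \<Prod>S"
    have n: "n = d * k S" "d > 0" "k S > 0"
      using nk assms(1) by (auto simp: d_def intro: Nat.gr0I)
    have cop: "coprime (k S) m" using assms(3) by (subst (asm) n(1)) simp
    \<comment> \<open>Positivity of \<open>k S\<close> keeps the subtraction from truncating, so the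
      factor \<open>inverse \<xi>\<close> in \<open>char_coeff\<close> produces the exponent of the
      derivative of \<open>X^k - 1\<close>.\<close>
    have "\<xi> ^ k S = \<xi> * \<xi> ^ (k S - 1)" using n(3) by (simp add: power_eq_if)
    hence "inverse \<xi> * \<xi> ^ k S = \<xi> ^ (k S - 1)" using \<xi>0 by simp
    hence "- (of_nat n / of_nat (totient m)) * ((- 1) ^ card S / of_nat d *
        (\<Sum>\<psi>\<in>dual_group m. char_coeff m \<psi> \<xi> * char_at m \<psi> (k S)))
        = - (of_nat n / of_nat (totient m)) * ((- 1) ^ card S / of_nat d *
        (of_nat (totient m) * (\<xi> ^ (k S - 1) / (1 - \<xi> ^ k S))))"
      using sum_char_coeff[OF assms(2) cop \<xi>m] by simp
    also have "\<dots> = - (of_nat n / of_nat d) * ((- 1) ^ card S * (\<xi> ^ (k S - 1) / (1 - \<xi> ^ k S)))"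
      using tot by simp
    also have "of_nat n / of_nat d = (of_nat (k S) :: complex)"
      using n(2) by (subst n(1)) simp
    \<comment> \<open>The leading minus sign of the formula turns \<open>1 - \<xi> ^ k S\<close>
      into \<open>\<xi> ^ k S - 1\<close>.\<close>
    also have "- of_nat (k S) * ((- 1) ^ card S * (\<xi> ^ (k S - 1) / (1 - \<xi> ^ k S)))
        = (- 1) ^ card S * (of_nat (k S) * \<xi> ^ (k S - 1) / - (1 - \<xi> ^ k S))"
      unfolding divide_minus_right by simp
    finally show ?thesis by (simp add: d_def)
  qed
  have "(\<Sum>\<psi>\<in>dual_group m. char_coeff m \<psi> \<xi> * char_at m \<psi> n *
        (\<Prod>p\<in>prime_factors n. 1 - cnj (char_at m \<psi> p) / of_nat p))
      = (\<Sum>\<psi>\<in>dual_group m. \<Sum>S\<in>P. (- 1) ^ card S / of_nat (\<Prod>S) *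
          (char_coeff m \<psi> \<xi> * char_at m \<psi> (k S)))"
    using char_at_mult_prod[of n m] assms(1,2,3)
    by (intro sum.cong refl) (simp add: mult.assoc sum_distrib_left P_def k_def mult.left_commute del: of_nat_prod)
  also have "\<dots> = (\<Sum>S\<in>P. (- 1) ^ card S / of_nat (\<Prod>S) *
          (\<Sum>\<psi>\<in>dual_group m. char_coeff m \<psi> \<xi> * char_at m \<psi> (k S)))"
    unfolding sum_distrib_left by (rule sum.swap)
  finally have swap: "(\<Sum>\<psi>\<in>dual_group m. char_coeff m \<psi> \<xi> * char_at m \<psi> n *
        (\<Prod>p\<in>prime_factors n. 1 - cnj (char_at m \<psi> p) / of_nat p))
      = (\<Sum>S\<in>P. (- 1) ^ card S / of_nat (\<Prod>S) *
          (\<Sum>\<psi>\<in>dual_group m. char_coeff m \<psi> \<xi> * char_at m \<psi> (k S)))" .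
  have "- (of_nat n / of_nat (totient m)) *
      (\<Sum>\<psi>\<in>dual_group m. char_coeff m \<psi> \<xi> * char_at m \<psi> n *
        (\<Prod>p\<in>prime_factors n. 1 - cnj (char_at m \<psi> p) / of_nat p))
      = (\<Sum>S\<in>P. (- 1) ^ card S * (of_nat (k S) * \<xi> ^ (k S - 1) / (\<xi> ^ k S - 1)))"
    unfolding swap sum_distrib_left[of _ _ P] by (intro sum.cong refl summand)
  also have "\<dots> = cyclotomic_logderiv n \<xi>"
    using cyclotomic_logderiv_eq_sum[OF _ \<xi>n] assms(1) by (simp add: P_def k_def)
  finally show ?thesis ..
qed

end
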